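(* Let $\ell\ge 1$, and for $0\le i\le\ell$ let $\mathrm{C}_i$ be a nonsingular $sN_i\times sN_i$ matrix that is monolithic, $\mathrm{C}_i=\mathrm{X}_i\,\mathrm{diag}_{1\le j\le s}(C_{i,j})\,\mathrm{X}_i^{-1}$. For $1\le i\le\ell$ let $\mathrm{W}_i$ be a nonsingular $sN_i\times sN_i$ matrix, $\mathrm{S}_i=\mathrm{I}-\mathrm{W}_i^{-1}\mathrm{C}_i$, and, for integers $\nu_1,\nu_2\ge0$ and $\gamma\ge1$, let the multigrid iteration matrices be $$\mathrm{T}_0=0,\qquad \mathrm{T}_i=\mathrm{S}_i^{\nu_2}\left(\mathrm{I}-\mathrm{P}_i\left(\mathrm{I}-\mathrm{T}_{i-1}^\gamma\right)\mathrm{C}_{i-1}^{-1}\mathrm{R}_i\mathrm{C}_i\right)\mathrm{S}_i^{\nu_1},\quad 1\le i\le \ell.$$ If all the $\mathrm{W}_i$ are monolithic, $\mathrm{W}_i=\mathrm{X}_i\,\mathrm{diag}_{1\le j\le s}(W_{i,j})\,\mathrm{X}_i^{-1}$, then every $\mathrm{T}_i$ is monolithic, $\mathrm{T}_i=\mathrm{X}_i\,\mathrm{diag}_{1\le j\le s}(T_{i,j})\,\mathrm{X}_i^{-1}$, and for $1\le i\le\ell$ $$\mathrm{T}_i=\mathrm{X}_i\,\mathrm{diag}_{1\le j\le s}\left[S_{i,j}^{\nu_2}\left(I-P_i\left(I-T_{i-1,j}^\gamma\right)C_{i-1,j}^{-1}R_iC_{i,j}\right)S_{i,j}^{\nu_1}\right]\mathrm{X}_i^{-1},$$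 where $S_{i,j}=I-W_{i,j}^{-1}C_{i,j}$ and $T_{0,j}=0$.
   Context: $X\in\mathbb{C}^{s\times s}$ is an invertible matrix, namely the eigenvector matrix in $A=X\Lambda X^{-1}$, where the Butcher matrix $A\in\mathbb{R}^{s\times s}$ of an $s$-stage Runge-Kutta method is assumed diagonalizable. $V_h^0\subset V_h^1\subset\dots\subset V_h^\ell$ are nested finite-dimensional (finite element) spaces with bases, $N_i=\dim V_h^i$, and $\mathrm{X}_i=X\otimes I_{N_i}$ ($\otimes$ is the Kronecker product). For $1\le i\le\ell$, $P_i$ ($N_i\times N_{i-1}$) is the matrix of the inclusion $V_h^{i-1}\to V_h^i$ (prolongation) and $R_i$ ($N_{i-1}\times N_i$) is a restriction matrix; $\mathrm{P}_i=I_s\otimes P_i$, $\mathrm{R}_i=I_s\otimes R_i$. The integers $\nu_1,\nu_2$ are the numbers of pre- and post-smoothing steps and $\gamma$ the number of recursive calls ($\gamma=1$: V-cycle, $\gamma=2$: W-cycle). Definition (monolithic). An $sN_i\times sN_i$ matrix $\mathrm{Y}$ is monolithic (with respect to $\mathrm{X}_i$) if there are $N_i\times N_i$ complex matrices $Y_1,\dots,Y_s$ with $\mathrm{X}_i^{-1}\mathrm{Y}\mathrm{X}_i=\mathrm{diag}_{1\le j\le s}Y_j$ (block diagonal). *)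

theory Defs
  imports
    Complex_Main
    "Jordan_Normal_Form.Matrix"
    "Jordan_Normal_Form.Gauss_Jordan_Elimination"
    "Jordan_Normal_Form.Ring_Hom_Matrix"
begin

text \<open>Only meaningful for invertible matrices: otherwise \<open>mat_inverse\<close> is \<open>None\<close>.\<close>

definition mat_inv :: "'a :: field mat \<Rightarrow> 'a mat" where
  "mat_inv A = the (mat_inverse A)"

lemma mat_inv:
  assumes A: "A \<in> carrier_mat n n" and inv: "invertible_mat A"
  shows "mat_inv A \<in> carrier_mat n n" "A * mat_inv A = 1\<^sub>m n" "mat_inv A * A = 1\<^sub>m n"
proof -
  obtain B where AB: "A * B = 1\<^sub>m n" and BA: "B * A = 1\<^sub>m (dim_row B)"
    using inv A unfolding invertible_mat_def inverts_mat_def by auto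
  have col: "dim_col B = n" using arg_cong[OF AB, of dim_col] by simp
  have row: "dim_row B = n" using arg_cong[OF BA, of dim_col] A by simp
  have B: "B \<in> carrier_mat n n" using col row by auto
  have "A \<in> Units (ring_mat TYPE('a) n ())"
    unfolding Units_def using A B AB BA row by (auto simp: ring_mat_def)
  then have "mat_inverse A \<noteq> None" using mat_inverse(1)[OF A, where b = "()"] by blast
  then have "mat_inverse A = Some (mat_inv A)" by (auto simp: mat_inv_def)
  from mat_inverse(2)[OF A this]
  show "mat_inv A \<in> carrier_mat n n" "A * mat_inv A = 1\<^sub>m n" "mat_inv A * A = 1\<^sub>m n"
    by auto
qed

definition kronecker :: "'a :: times mat \<Rightarrow> 'a mat \<Rightarrow> 'a mat" (infixl \<open>\<otimes>\<^sub>K\<close> 71) where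
  "A \<otimes>\<^sub>K B = mat (dim_row A * dim_row B) (dim_col A * dim_col B)
     (\<lambda>(p, q). A $$ (p div dim_row B, q div dim_col B) * B $$ (p mod dim_row B, q mod dim_col B))"

text \<open>The blocks are numbered from \<open>0\<close> to \<open>s - 1\<close>.\<close>

definition block_diag :: "nat \<Rightarrow> (nat \<Rightarrow> 'a :: zero mat) \<Rightarrow> 'a mat" where
  "block_diag s Y = diag_block_mat (map Y [0..<s])"

text \<open>Here \<open>XX\<close> stands for \<open>X \<otimes>\<^sub>K 1\<^sub>m n\<close>, where \<open>X\<close> is the \<open>s \<times> s\<close> eigenvector matrix.\<close>

definition monolithic :: "nat \<Rightarrow> nat \<Rightarrow> complex mat \<Rightarrow> complex mat \<Rightarrow> bool" where
  "monolithic s n XX Y \<longleftrightarrow> Y \<in> carrier_mat (s * n) (s * n) \<and>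
     (\<exists>Z. (\<forall>j<s. Z j \<in> carrier_mat n n) \<and> mat_inv XX * Y * XX = block_diag s Z)"

definition is_basis ::
  "('k :: field \<Rightarrow> 'v :: ab_group_add \<Rightarrow> 'v) \<Rightarrow> 'v set \<Rightarrow> nat \<Rightarrow> (nat \<Rightarrow> 'v) \<Rightarrow> bool" where
  "is_basis scale V n b \<longleftrightarrow> inj_on b {..<n} \<and> \<not> Modules.module.dependent scale (b ` {..<n}) \<and>
     Modules.module.span scale (b ` {..<n}) = V"

text \<open>\<open>Q\<close> is the matrix, with respect to the bases \<open>b\<close> (of size \<open>m\<close>) and \<open>b'\<close> (of size \<open>n\<close>),
  of the inclusion of the span of \<open>b\<close> into the span of \<open>b'\<close>: column \<open>k\<close> holds the coordinates
  of \<open>b k\<close>.\<close>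

definition is_inclusion_mat ::
  "('k :: field \<Rightarrow> 'v :: ab_group_add \<Rightarrow> 'v) \<Rightarrow> nat \<Rightarrow> (nat \<Rightarrow> 'v) \<Rightarrow> nat \<Rightarrow> (nat \<Rightarrow> 'v) \<Rightarrow>
   'k mat \<Rightarrow> bool" where
  "is_inclusion_mat scale m b n b' Q \<longleftrightarrow> Q \<in> carrier_mat n m \<and>
     (\<forall>k<m. b k = (\<Sum>r<n. scale (Q $$ (r, k)) (b' r)))"

end

theory Submission
  imports Defs "Jordan_Normal_Form.Determinant"
begin

text \<open>Conjugation by \<open>X \<otimes>\<^sub>K 1\<close> turns block diagonal matrices with rectangular blocks into an
  algebra that is closed under products, differences, powers and inverses, all taken block by
  block. The transfer matrices \<open>1 \<otimes>\<^sub>K P\<close> belong to it because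
  \<open>(X \<otimes>\<^sub>K 1) * (1 \<otimes>\<^sub>K P) = X \<otimes>\<^sub>K P = (1 \<otimes>\<^sub>K P) * (X \<otimes>\<^sub>K 1)\<close>, so every operation in the multigrid
  recursion stays inside it.\<close>

section \<open>Kronecker products and the mixed-product rule\<close>

lemma sum_div_mod:
  fixes f g :: "nat \<Rightarrow> 'a :: semiring_0"
  shows "(\<Sum>r<c * d. f (r div d) * g (r mod d)) = sum f {..<c} * sum g {..<d}"
proof -
  \<comment> \<open>The range splits into \<open>c\<close> consecutive runs of length
    \<open>d\<close>. On run number \<open>m\<close> the quotient is constantly \<open>m\<close>
    while the remainder passes once through all values below \<open>d\<close>.\<close>
  have "(\<Sum>r = m * d..<m * d + d. f (r div d) * g (r mod d)) = f m * sum g {..<d}" for m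
  proof -
    have "(\<Sum>r = m * d..<m * d + d. f (r div d) * g (r mod d)) =
        (\<Sum>r = 0..<d. f ((r + m * d) div d) * g ((r + m * d) mod d))"
      using sum.shift_bounds_nat_ivl[of "\<lambda>r. f (r div d) * g (r mod d)" 0 "m * d" d]
      by (simp add: add.commute)
    also have "\<dots> = (\<Sum>r<d. f m * g r)"
      by (intro sum.cong) auto
    finally show ?thesis
      by (simp add: sum_distrib_left)
  qed
  then show ?thesis
    by (simp add: sum.nat_group[symmetric] sum_distrib_right)
qed

lemma kronecker_carrier_mat:
  assumes "A \<in> carrier_mat a b" "B \<in> carrier_mat c d"
  shows "A \<otimes>\<^sub>K B \<in> carrier_mat (a * c) (b * d)"
  using assms by (auto simp: kronecker_def)

lemma kronecker_index:
  assumes "A \<in> carrier_mat a b" "B \<in> carrier_mat c d" "p < a * c" "q < b * d"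
  shows "(A \<otimes>\<^sub>K B) $$ (p, q) = A $$ (p div c, q div d) * B $$ (p mod c, q mod d)"
  using assms by (auto simp: kronecker_def)

lemma div_mod_less_mult:
  fixes p :: nat
  assumes "p < a * c"
  shows "p div c < a" "p mod c < c"
  using assms by (cases "c = 0"; simp add: less_mult_imp_div_less)+

text \<open>An inner index \<open>r < b * d\<close> encodes the pair
  \<open>(r div d, r mod d)\<close>. Once commutativity has moved the entries of \<open>A\<close>
  and \<open>C\<close> together, the sum over \<open>r\<close> factors into two independent scalar
  products.\<close>

lemma kronecker_mult:
  fixes A B C D :: "'a :: comm_semiring_0 mat"
  assumes A: "A \<in> carrier_mat a b" and B: "B \<in> carrier_mat c d"
    and C: "C \<in> carrier_mat b e" and D: "D \<in> carrier_mat d f"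
  shows "(A \<otimes>\<^sub>K B) * (C \<otimes>\<^sub>K D) = (A * C) \<otimes>\<^sub>K (B * D)"
proof (rule eq_matI)
  note AB = kronecker_carrier_mat[OF A B] and CD = kronecker_carrier_mat[OF C D]
  have AC: "A * C \<in> carrier_mat a e" and BD: "B * D \<in> carrier_mat c f"
    using assms by auto
  note ACBD = kronecker_carrier_mat[OF AC BD]
  show "dim_row ((A \<otimes>\<^sub>K B) * (C \<otimes>\<^sub>K D)) = dim_row ((A * C) \<otimes>\<^sub>K (B * D))"
    "dim_col ((A \<otimes>\<^sub>K B) * (C \<otimes>\<^sub>K D)) = dim_col ((A * C) \<otimes>\<^sub>K (B * D))"
    using AB CD ACBD by auto
  fix p q
  assume "p < dim_row ((A * C) \<otimes>\<^sub>K (B * D))" "q < dim_col ((A * C) \<otimes>\<^sub>K (B * D))"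
  then have p: "p < a * c" and q: "q < e * f"
    using ACBD by auto
  note pq = div_mod_less_mult[OF p] div_mod_less_mult[OF q]
  have "((A \<otimes>\<^sub>K B) * (C \<otimes>\<^sub>K D)) $$ (p, q) =
      (\<Sum>r<b * d. (A \<otimes>\<^sub>K B) $$ (p, r) * (C \<otimes>\<^sub>K D) $$ (r, q))"
    using AB CD p q by (simp add: scalar_prod_def atLeast0LessThan)
  also have "\<dots> = (\<Sum>r<b * d. (A $$ (p div c, r div d) * C $$ (r div d, q div f)) *
      (B $$ (p mod c, r mod d) * D $$ (r mod d, q mod f)))"
    using p q
    by (intro sum.cong) (auto simp: kronecker_index[OF A B] kronecker_index[OF C D] ac_simps)
  also have "\<dots> = (\<Sum>r<b. A $$ (p div c, r) * C $$ (r, q div f)) *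
      (\<Sum>r<d. B $$ (p mod c, r) * D $$ (r, q mod f))"
    by (rule sum_div_mod)
  also have "\<dots> = ((A * C) \<otimes>\<^sub>K (B * D)) $$ (p, q)"
    using assms pq
    by (simp add: kronecker_index[OF AC BD p q] scalar_prod_def atLeast0LessThan)
  finally show "((A \<otimes>\<^sub>K B) * (C \<otimes>\<^sub>K D)) $$ (p, q) = ((A * C) \<otimes>\<^sub>K (B * D)) $$ (p, q)" .
qed

section \<open>Block diagonal matrices with rectangular blocks\<close>

lemma block_diag_0: "block_diag 0 Y = 0\<^sub>m 0 0"
  by (simp add: block_diag_def)

lemma block_diag_cong: "(\<And>j. j < s \<Longrightarrow> Y j = Z j) \<Longrightarrow> block_diag s Y = block_diag s Z"
  by (auto simp: block_diag_def intro!: arg_cong[of _ _ diag_block_mat])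

lemma block_diag_carrier_mat:
  assumes "\<forall>j<s. Y j \<in> carrier_mat n m"
  shows "block_diag s Y \<in> carrier_mat (s * n) (s * m)"
proof -
  have "map (dim_row \<circ> Y) [0..<s] = map (\<lambda>_. n) [0..<s]"
    "map (dim_col \<circ> Y) [0..<s] = map (\<lambda>_. m) [0..<s]"
    using assms by (auto intro!: map_cong)
  then show ?thesis
    by (auto simp: block_diag_def dim_diag_block_mat map_replicate_const sum_list_replicate)
qed

text \<open>Splitting off the last block lets an induction on \<open>s\<close> reduce statements
  about block diagonal matrices to 2 by 2 block computations. The uniform block shape makes the
  sizes of the zero blocks explicit.\<close>

lemma block_diag_Suc:
  assumes "\<forall>j<Suc s. Y j \<in> carrier_mat n m"
  shows "block_diag (Suc s) Y =
    four_block_mat (block_diag s Y) (0\<^sub>m (s * n) m) (0\<^sub>m n (s * m)) (Y s)"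
  using block_diag_carrier_mat[of s Y n m] assms
  by (auto simp: block_diag_def diag_block_mat_last Let_def)

lemma block_diag_mult:
  fixes Y Z :: "nat \<Rightarrow> 'a :: semiring_0 mat"
  assumes "\<forall>j<s. Y j \<in> carrier_mat n m" "\<forall>j<s. Z j \<in> carrier_mat m k"
  shows "block_diag s Y * block_diag s Z = block_diag s (\<lambda>j. Y j * Z j)"
  using assms
proof (induction s)
  case 0
  show ?case
    by (simp add: block_diag_0)
next
  case (Suc s)
  have YZ: "Y j * Z j \<in> carrier_mat n k" if "j < Suc s" for j
    using Suc.prems that by (auto intro: mult_carrier_mat)
  have carrier: "block_diag s Y \<in> carrier_mat (s * n) (s * m)"
    "block_diag s Z \<in> carrier_mat (s * m) (s * k)" "Y s \<in> carrier_mat n m" "Z s \<in> carrier_mat m k"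
    using Suc.prems by (auto intro!: block_diag_carrier_mat)
  have IH: "block_diag s Y * block_diag s Z = block_diag s (\<lambda>j. Y j * Z j)"
    using Suc by simp
  have YZs: "block_diag s (\<lambda>j. Y j * Z j) \<in> carrier_mat (s * n) (s * k)"
    "Y s * Z s \<in> carrier_mat n k"
    using YZ by (auto intro!: block_diag_carrier_mat)
  have split: "block_diag (Suc s) Y =
      four_block_mat (block_diag s Y) (0\<^sub>m (s * n) m) (0\<^sub>m n (s * m)) (Y s)"
    "block_diag (Suc s) Z =
      four_block_mat (block_diag s Z) (0\<^sub>m (s * m) k) (0\<^sub>m m (s * k)) (Z s)"
    "block_diag (Suc s) (\<lambda>j. Y j * Z j) =
      four_block_mat (block_diag s (\<lambda>j. Y j * Z j)) (0\<^sub>m (s * n) k) (0\<^sub>m n (s * k)) (Y s * Z s)"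
    using Suc.prems YZ by (auto intro!: block_diag_Suc)
  show ?case
    unfolding split
    by (subst mult_four_block_mat[OF carrier(1) zero_carrier_mat zero_carrier_mat carrier(3)
          carrier(2) zero_carrier_mat zero_carrier_mat carrier(4)])
      (use carrier YZs in \<open>simp add: IH\<close>)
qed

lemma block_diag_minus:
  fixes Y Z :: "nat \<Rightarrow> 'a :: group_add mat"
  assumes "\<forall>j<s. Y j \<in> carrier_mat n m" "\<forall>j<s. Z j \<in> carrier_mat n m"
  shows "block_diag s Y - block_diag s Z = block_diag s (\<lambda>j. Y j - Z j)"
  using assms
proof (induction s)
  case 0
  show ?case
    by (auto simp: block_diag_0)
next
  case (Suc s)
  have YZ: "Y j - Z j \<in> carrier_mat n m" if "j < Suc s" for j
    using Suc.prems that by (auto intro!: minus_carrier_mat)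
  have IH: "block_diag s Y - block_diag s Z = block_diag s (\<lambda>j. Y j - Z j)"
    using Suc by simp
  have carrier: "block_diag s Y \<in> carrier_mat (s * n) (s * m)"
    "block_diag s Z \<in> carrier_mat (s * n) (s * m)" "Y s \<in> carrier_mat n m" "Z s \<in> carrier_mat n m"
    using Suc.prems by (auto intro!: block_diag_carrier_mat)
  have split: "block_diag (Suc s) Y =
      four_block_mat (block_diag s Y) (0\<^sub>m (s * n) m) (0\<^sub>m n (s * m)) (Y s)"
    "block_diag (Suc s) Z =
      four_block_mat (block_diag s Z) (0\<^sub>m (s * n) m) (0\<^sub>m n (s * m)) (Z s)"
    "block_diag (Suc s) (\<lambda>j. Y j - Z j) =
      four_block_mat (block_diag s (\<lambda>j. Y j - Z j)) (0\<^sub>m (s * n) m) (0\<^sub>m n (s * m)) (Y s - Z s)"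
    using Suc.prems YZ by (auto intro!: block_diag_Suc)
  show ?case
    unfolding split IH[symmetric]
    by (rule eq_matI) (use carrier in auto)
qed

text \<open>This links the two descriptions of a transfer matrix: repeated blocks on the diagonal,
  which the block calculus handles, and a Kronecker product, which commutes past \<open>X\<close> by
  the mixed-product rule.\<close>

lemma block_diag_const:
  fixes P :: "'a :: semiring_1 mat"
  assumes P: "P \<in> carrier_mat n m"
  shows "block_diag s (\<lambda>_. P) = 1\<^sub>m s \<otimes>\<^sub>K P"
proof (induction s)
  case 0
  show ?case
    by (auto simp: block_diag_0 kronecker_def)
next
  case (Suc s)
  have first_blocks: "p div d < s \<and> p div d \<noteq> s" if "p < s * d" for p d :: nat
    using div_mod_less_mult(1)[OF that] by simp
  \<comment> \<open>An index from \<open>s * d\<close> on falls into the last block: its quotient is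
    \<open>s\<close> and its remainder is the offset inside that block.\<close>
  have last_block: "p div d = s" "p mod d = p - s * d"
    if "p < d + s * d" "\<not> p < s * d" for p d :: nat
    proof -
    show "p div d = s"
      using that by (intro div_nat_eqI) (auto simp: ac_simps)
    then show "p mod d = p - s * d"
      by (simp add: modulo_nat_def)
  qed
  show ?case
  proof (rule eq_matI)
    fix p q
    assume "p < dim_row (1\<^sub>m (Suc s) \<otimes>\<^sub>K P)" "q < dim_col (1\<^sub>m (Suc s) \<otimes>\<^sub>K P)"
    then have p: "p < n + s * n" and q: "q < m + s * m"
      using P by (auto simp: kronecker_def)
    show "block_diag (Suc s) (\<lambda>_. P) $$ (p, q) = (1\<^sub>m (Suc s) \<otimes>\<^sub>K P) $$ (p, q)"
      \<comment> \<open>The four cases are the four quadrants of \<open>block_diag_Suc\<close>. In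
        the two off-diagonal ones the quotients of \<open>p\<close> and \<open>q\<close> differ, so
        the entry of the identity factor vanishes.\<close>
      using P p q first_blocks[of p n] first_blocks[of q m] last_block[OF p] last_block[OF q]
      by (cases "p < s * n"; cases "q < s * m")
        (auto simp: block_diag_Suc[of s _ n m] Suc kronecker_def less_mult_imp_div_less)
  qed (use P in \<open>auto simp: block_diag_Suc[of s _ n m] Suc kronecker_def\<close>)
qed

lemma block_diag_one: "block_diag s (\<lambda>_. 1\<^sub>m n) = (1\<^sub>m (s * n) :: 'a :: semiring_1 mat)"
  \<comment> \<open>The zero matrices in this list matter only through their dimensions, which set
    the sizes of the identity blocks.\<close>
  using diag_block_one_mat[of "map (\<lambda>_. 0\<^sub>m n n :: 'a mat) [0..<s]"]
  by (simp add: block_diag_def o_def sum_list_triv)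

text \<open>A zero quadrant makes the determinant multiplicative in the two diagonal quadrants. The
  formula serves to pass nonsingularity from the whole matrix to each block.\<close>

lemma det_block_diag:
  fixes Y :: "nat \<Rightarrow> 'a :: idom mat"
  assumes "\<forall>j<s. Y j \<in> carrier_mat n n"
  shows "det (block_diag s Y) = (\<Prod>j<s. det (Y j))"
  using assms
proof (induction s)
  case 0
  show ?case
    by (simp add: block_diag_0 det_def)
next
  case (Suc s)
  have "block_diag s Y \<in> carrier_mat (s * n) (s * n)" "Y s \<in> carrier_mat n n"
    using Suc.prems by (auto intro!: block_diag_carrier_mat)
  moreover have "block_diag (Suc s) Y =
      four_block_mat (block_diag s Y) (0\<^sub>m (s * n) n) (0\<^sub>m n (s * n)) (Y s)"
    using Suc.prems by (rule block_diag_Suc)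
  ultimately have "det (block_diag (Suc s) Y) = det (block_diag s Y) * det (Y s)"
    by (auto intro!: det_four_block_mat_lower_left_zero)
  with Suc show ?case
    by simp
qed

section \<open>Uniqueness of inverses and the determinant criterion\<close>

lemma invertible_matI:
  assumes "A \<in> carrier_mat n n" "B \<in> carrier_mat n n" "A * B = 1\<^sub>m n" "B * A = 1\<^sub>m n"
  shows "invertible_mat A"
  using assms by (auto simp: invertible_mat_def inverts_mat_def)

text \<open>Exhibiting a two-sided inverse determines \<open>mat_inv\<close>, with no need to look
  into the elimination behind \<open>mat_inverse\<close>.\<close>

lemma mat_inv_unique:
  fixes A :: "'a :: field mat"
  assumes A: "A \<in> carrier_mat n n" and B: "B \<in> carrier_mat n n"
    and AB: "A * B = 1\<^sub>m n" and BA: "B * A = 1\<^sub>m n"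
  shows "mat_inv A = B"
proof -
  note inv = mat_inv[OF A invertible_matI[OF A B AB BA]]
  have "mat_inv A = (B * A) * mat_inv A"
    using inv BA by simp
  also have "\<dots> = B"
    using inv A B by (simp add: assoc_mult_mat[of B n n A n _ n])
  finally show ?thesis .
qed

lemma invertible_mat_if_det_nonzero:
  fixes A :: "'a :: field mat"
  assumes A: "A \<in> carrier_mat n n" and "det A \<noteq> 0"
  shows "invertible_mat A"
  using det_non_zero_imp_unit[OF assms, of "()"] A
  by (auto simp: Units_def ring_mat_def intro: invertible_matI)

section \<open>The algebra of conjugated block diagonal matrices\<close>

definition block_conj ::
  "nat \<Rightarrow> 'a :: field mat \<Rightarrow> nat \<Rightarrow> nat \<Rightarrow> (nat \<Rightarrow> 'a mat) \<Rightarrow> 'a mat" where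
  "block_conj s X n m Y = (X \<otimes>\<^sub>K 1\<^sub>m n) * block_diag s Y * mat_inv (X \<otimes>\<^sub>K 1\<^sub>m m)"

lemma block_conj_cong:
  "(\<And>j. j < s \<Longrightarrow> Y j = Z j) \<Longrightarrow> block_conj s X n m Y = block_conj s X n m Z"
  unfolding block_conj_def using block_diag_cong[of s Y Z] by simp

context
  fixes s :: nat and X :: "'a :: field mat"
  assumes X: "X \<in> carrier_mat s s" "invertible_mat X"
begin

text \<open>By the mixed-product rule, \<open>mat_inv X \<otimes>\<^sub>K 1\<^sub>m n\<close> is a
  two-sided inverse.\<close>

lemma kronecker_one:
  shows kronecker_one_carrier_mat: "X \<otimes>\<^sub>K 1\<^sub>m n \<in> carrier_mat (s * n) (s * n)"
    and invertible_kronecker_one: "invertible_mat (X \<otimes>\<^sub>K 1\<^sub>m n)"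
proof -
  note inv = mat_inv[OF X]
  note one = one_carrier_mat[of n]
  have "1\<^sub>m s \<otimes>\<^sub>K 1\<^sub>m n = (1\<^sub>m (s * n) :: 'a mat)"
    using block_diag_const[OF one] block_diag_one by metis
  then show "X \<otimes>\<^sub>K 1\<^sub>m n \<in> carrier_mat (s * n) (s * n)" "invertible_mat (X \<otimes>\<^sub>K 1\<^sub>m n)"
    using kronecker_mult[OF X(1) one inv(1) one] kronecker_mult[OF inv(1) one X(1) one] inv
    by (auto intro!: invertible_matI[of _ "s * n" "mat_inv X \<otimes>\<^sub>K 1\<^sub>m n"] kronecker_carrier_mat X)
qed

lemmas kronecker_one_inv = mat_inv[OF kronecker_one_carrier_mat invertible_kronecker_one]

lemma block_conj_carrier_mat:
  assumes "\<forall>j<s. Y j \<in> carrier_mat n m"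
  shows "block_conj s X n m Y \<in> carrier_mat (s * n) (s * m)"
  unfolding block_conj_def
  using kronecker_one_carrier_mat block_diag_carrier_mat[OF assms] kronecker_one_inv(1)
  by (intro mult_carrier_mat)

text \<open>The two conjugating factors of the intermediate size \<open>m\<close> meet in the middle
  and cancel; the rest is reassociation. Giving \<open>block_conj\<close> separate row and column
  block sizes makes this work for products that pass between levels.\<close>

lemma block_conj_mult:
  assumes Y: "\<forall>j<s. Y j \<in> carrier_mat n m" and Z: "\<forall>j<s. Z j \<in> carrier_mat m k"
  shows "block_conj s X n m Y * block_conj s X m k Z = block_conj s X n k (\<lambda>j. Y j * Z j)"
proof -
  note D = block_diag_carrier_mat[OF Y] block_diag_carrier_mat[OF Z]
  have "mat_inv (X \<otimes>\<^sub>K 1\<^sub>m m) * ((X \<otimes>\<^sub>K 1\<^sub>m m) * (block_diag s Z * mat_inv (X \<otimes>\<^sub>K 1\<^sub>m k))) =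
      block_diag s Z * mat_inv (X \<otimes>\<^sub>K 1\<^sub>m k)"
    using D(2) kronecker_one_inv[of m] kronecker_one_inv(1)[of k] kronecker_one_carrier_mat[of m]
    by (simp flip: assoc_mult_mat[of _ "s * m" "s * m" _ "s * m" _ "s * k"])
  then show ?thesis
    using D kronecker_one_inv(1)[of m] kronecker_one_inv(1)[of k]
      kronecker_one_carrier_mat[of m] kronecker_one_carrier_mat[of n]
    by (simp add: block_conj_def flip: block_diag_mult[OF Y Z])
       (simp add: assoc_mult_mat[of _ "s * n" "s * n" _ "s * m" _ "s * k"]
         assoc_mult_mat[of _ "s * n" "s * n" _ "s * m" _ "s * m"]
         assoc_mult_mat[of _ "s * n" "s * m" _ "s * m" _ "s * k"]
         assoc_mult_mat[of _ "s * m" "s * m" _ "s * k" _ "s * k"]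
         assoc_mult_mat[of _ "s * n" "s * m" _ "s * k" _ "s * k"]
         assoc_mult_mat[of _ "s * n" "s * n" _ "s * k" _ "s * k"])
qed

lemma block_conj_minus:
  assumes Y: "\<forall>j<s. Y j \<in> carrier_mat n m" and Z: "\<forall>j<s. Z j \<in> carrier_mat n m"
  shows "block_conj s X n m Y - block_conj s X n m Z = block_conj s X n m (\<lambda>j. Y j - Z j)"
proof -
  note D = block_diag_carrier_mat[OF Y] block_diag_carrier_mat[OF Z]
  note K = kronecker_one_carrier_mat[of n]
  show ?thesis
    unfolding block_conj_def block_diag_minus[OF Y Z, symmetric]
    by (simp only: mult_minus_distrib_mat[OF K D]
        minus_mult_distrib_mat[OF mult_carrier_mat[OF K D(1)] mult_carrier_mat[OF K D(2)]
          kronecker_one_inv(1)])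
qed

lemma block_conj_const:
  assumes P: "P \<in> carrier_mat n m"
  shows "block_conj s X n m (\<lambda>_. P) = 1\<^sub>m s \<otimes>\<^sub>K P"
proof -
  have K: "1\<^sub>m s \<otimes>\<^sub>K P \<in> carrier_mat (s * n) (s * m)"
    using P by (intro kronecker_carrier_mat) auto
  have "(X \<otimes>\<^sub>K 1\<^sub>m n) * (1\<^sub>m s \<otimes>\<^sub>K P) = (1\<^sub>m s \<otimes>\<^sub>K P) * (X \<otimes>\<^sub>K 1\<^sub>m m)"
    using X P by (simp add: kronecker_mult[of _ s s _ n n _ s _ m]
        kronecker_mult[of _ s s _ n m _ s _ m])
  then show ?thesis
    using K kronecker_one_inv[of m] kronecker_one_carrier_mat[of m]
    by (simp add: block_conj_def block_diag_const[OF P]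
        assoc_mult_mat[of _ "s * n" "s * m" _ "s * m" _ "s * m"])
qed

lemma block_conj_one: "block_conj s X n n (\<lambda>_. 1\<^sub>m n) = 1\<^sub>m (s * n)"
  using block_conj_const[of "1\<^sub>m n" n n] block_diag_const[of "1\<^sub>m n :: 'a mat" n n s]
  by (simp add: block_diag_one)

lemma block_conj_zero: "block_conj s X n n (\<lambda>_. 0\<^sub>m n n) = 0\<^sub>m (s * n) (s * n)"
proof -
  \<comment> \<open>Zero is written as \<open>1 - 1\<close>, so that the rules for the identity and
    for differences apply.\<close>
  have "block_conj s X n n (\<lambda>_. 1\<^sub>m n - 1\<^sub>m n) = 1\<^sub>m (s * n) - 1\<^sub>m (s * n)"
    by (simp add: block_conj_one flip: block_conj_minus)
  then show ?thesis
    by (simp add: minus_r_inv_mat[of _ n n] minus_r_inv_mat[of _ "s * n" "s * n"])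
qed

lemma block_conj_pow:
  assumes Y: "\<forall>j<s. Y j \<in> carrier_mat n n"
  shows "block_conj s X n n Y ^\<^sub>m k = block_conj s X n n (\<lambda>j. Y j ^\<^sub>m k)"
proof (induction k)
  case 0
  \<comment> \<open>The zeroth power of \<open>Y j\<close> is the identity of size
    \<open>dim_row (Y j)\<close>, which is known to be \<open>n\<close> for \<open>j < s\<close>;
    hence the passage through the congruence rule.\<close>
  have "block_conj s X n n (\<lambda>j. Y j ^\<^sub>m 0) = block_conj s X n n (\<lambda>_. 1\<^sub>m n)"
    using Y by (intro block_conj_cong) auto
  then show ?case
    using block_conj_carrier_mat[OF Y] by (simp add: block_conj_one)
next
  case (Suc k)
  have "Y j ^\<^sub>m k \<in> carrier_mat n n" if "j < s" for j
    using Y[rule_format, OF that] by simp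
  then show ?case
    using Y by (simp add: Suc block_conj_mult)
qed

text \<open>Undoing the conjugation returns the blocks themselves, which are the witness that
  \<open>monolithic\<close> asks for.\<close>

lemma conj_block_conj:
  assumes Y: "\<forall>j<s. Y j \<in> carrier_mat n n"
  shows "mat_inv (X \<otimes>\<^sub>K 1\<^sub>m n) * block_conj s X n n Y * (X \<otimes>\<^sub>K 1\<^sub>m n) = block_diag s Y"
proof -
  define K where "K = X \<otimes>\<^sub>K 1\<^sub>m n"
  define L where "L = mat_inv K"
  have K: "K \<in> carrier_mat (s * n) (s * n)" and L: "L \<in> carrier_mat (s * n) (s * n)"
    and LK: "L * K = 1\<^sub>m (s * n)"
    unfolding K_def L_def using kronecker_one_carrier_mat kronecker_one_inv by auto
  have D: "block_diag s Y \<in> carrier_mat (s * n) (s * n)"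
    using Y by (rule block_diag_carrier_mat)
  have "L * (K * block_diag s Y * L) * K = (L * K) * block_diag s Y * (L * K)"
    using K L D by (simp add: assoc_mult_mat[of _ "s * n" "s * n" _ "s * n" _ "s * n"])
  then show ?thesis
    using D LK by (simp add: block_conj_def K_def L_def)
qed

text \<open>\<open>mat_inv\<close> of a block is meaningful only if that block is invertible, while
  the multigrid data give invertibility of whole matrices. Determinants bridge the gap: the
  determinant of the whole has the product of the block determinants as a factor, so none of them is
  zero.\<close>

lemma invertible_blocks:
  assumes Y: "\<forall>j<s. Y j \<in> carrier_mat n n"
    and inv: "invertible_mat (block_conj s X n n Y)" and j: "j < s"
  shows "invertible_mat (Y j)"
proof -
  have D: "block_diag s Y \<in> carrier_mat (s * n) (s * n)"
    using Y by (rule block_diag_carrier_mat)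
  note C = block_conj_carrier_mat[OF Y] and K = kronecker_one_carrier_mat[of n]
    and L = kronecker_one_inv(1)[of n]
  have "det (block_conj s X n n Y) * det (mat_inv (block_conj s X n n Y)) = 1"
    using mat_inv[OF C inv] C by (simp flip: det_mult)
  moreover have "det (block_conj s X n n Y) =
      det (X \<otimes>\<^sub>K 1\<^sub>m n) * det (block_diag s Y) * det (mat_inv (X \<otimes>\<^sub>K 1\<^sub>m n))"
    unfolding block_conj_def using det_mult[OF mult_carrier_mat[OF K D] L] det_mult[OF K D] by simp
  ultimately have "det (block_diag s Y) \<noteq> 0"
    by auto
  then have "det (Y j) \<noteq> 0"
    using j by (simp add: det_block_diag[OF Y])
  then show ?thesis
    using Y[rule_format, OF j] by (rule invertible_mat_if_det_nonzero[rotated])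
qed

text \<open>All blocks are invertible by \<open>invertible_blocks\<close>, so conjugating their
  inverses gives a two-sided inverse, and inverses are unique.\<close>

lemma mat_inv_block_conj:
  assumes Y: "\<forall>j<s. Y j \<in> carrier_mat n n"
    and inv: "invertible_mat (block_conj s X n n Y)"
  shows "mat_inv (block_conj s X n n Y) = block_conj s X n n (\<lambda>j. mat_inv (Y j))"
proof -
  note Y_inv = mat_inv[OF Y[rule_format] invertible_blocks[OF Y inv]]
  have "block_conj s X n n (\<lambda>j. Y j * mat_inv (Y j)) = block_conj s X n n (\<lambda>_. 1\<^sub>m n)"
    "block_conj s X n n (\<lambda>j. mat_inv (Y j) * Y j) = block_conj s X n n (\<lambda>_. 1\<^sub>m n)"
    using Y_inv by (auto intro!: block_conj_cong)
  then show ?thesis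
    using Y Y_inv(1)
    by (intro mat_inv_unique[of _ "s * n"] block_conj_carrier_mat)
      (auto simp: block_conj_mult block_conj_one)
qed

end

section \<open>Monolithicity and the multigrid recursion\<close>

lemma monolithic_block_conj:
  assumes "X \<in> carrier_mat s s" "invertible_mat X" "\<forall>j<s. Y j \<in> carrier_mat n n"
  shows "monolithic s n (X \<otimes>\<^sub>K 1\<^sub>m n) (block_conj s X n n Y)"
  unfolding monolithic_def
  using block_conj_carrier_mat[OF assms] conj_block_conj[OF assms] assms(3) by auto

text \<open>One passage from a coarse level with block size \<open>m\<close> to a fine level with
  block size \<open>n\<close>; \<open>D\<close> and \<open>T\<close> are the coarse blocks. The
  second claim supplies the block sizes required when the result becomes the coarse matrix of the
  next step.\<close>

lemma multigrid_step_block_conj: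
  fixes X :: "'a :: field mat" and g k\<^sub>1 k\<^sub>2 :: nat
  assumes X: "X \<in> carrier_mat s s" "invertible_mat X"
    and P: "P \<in> carrier_mat n m" and R: "R \<in> carrier_mat m n"
    and C: "\<forall>j<s. C j \<in> carrier_mat n n"
    and D: "\<forall>j<s. D j \<in> carrier_mat m m" "invertible_mat (block_conj s X m m D)"
    and W: "\<forall>j<s. W j \<in> carrier_mat n n" "invertible_mat (block_conj s X n n W)"
    and T: "\<forall>j<s. T j \<in> carrier_mat m m"
    and S: "\<forall>j<s. S j = 1\<^sub>m n - mat_inv (W j) * C j"
    and S': "S' = 1\<^sub>m (s * n) - mat_inv (block_conj s X n n W) * block_conj s X n n C"
  defines "F \<equiv> \<lambda>j. S j ^\<^sub>m k\<^sub>2 *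
    (1\<^sub>m n - P * (1\<^sub>m m - T j ^\<^sub>m g) * mat_inv (D j) * R * C j) * S j ^\<^sub>m k\<^sub>1"
  shows "S' ^\<^sub>m k\<^sub>2 *
      (1\<^sub>m (s * n) - (1\<^sub>m s \<otimes>\<^sub>K P) * (1\<^sub>m (s * m) - block_conj s X m m T ^\<^sub>m g) *
        mat_inv (block_conj s X m m D) * (1\<^sub>m s \<otimes>\<^sub>K R) * block_conj s X n n C) *
      S' ^\<^sub>m k\<^sub>1 = block_conj s X n n F"
    and "\<forall>j<s. F j \<in> carrier_mat n n"
proof -
  note to_block_conj = mat_inv_block_conj[OF X W] mat_inv_block_conj[OF X D]
    block_conj_one[OF X, symmetric] block_conj_const[OF X P, symmetric]
    block_conj_const[OF X R, symmetric]
  note conj_mult = block_conj_mult[OF X] and conj_minus = block_conj_minus[OF X]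
    and conj_pow = block_conj_pow[OF X]
  have one: "\<forall>j<s. 1\<^sub>m k \<in> carrier_mat k k" for k
    by simp
  have PR: "\<forall>j<s. P \<in> carrier_mat n m" "\<forall>j<s. R \<in> carrier_mat m n"
    using P R by auto
  have Wi: "\<forall>j<s. mat_inv (W j) \<in> carrier_mat n n"
    and Di: "\<forall>j<s. mat_inv (D j) \<in> carrier_mat m m"
    using mat_inv(1)[OF W(1)[rule_format] invertible_blocks[OF X W]]
      mat_inv(1)[OF D(1)[rule_format] invertible_blocks[OF X D]]
    by auto
  have WC: "\<forall>j<s. mat_inv (W j) * C j \<in> carrier_mat n n"
    using Wi C by (auto intro: mult_carrier_mat)
  have S_carrier: "\<forall>j<s. S j \<in> carrier_mat n n"
    using WC S by (auto intro: minus_carrier_mat)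
  have "S' = block_conj s X n n (\<lambda>j. 1\<^sub>m n - mat_inv (W j) * C j)"
    unfolding S' to_block_conj conj_mult[OF Wi C] conj_minus[OF one WC] ..
  then have S'_eq: "S' = block_conj s X n n S"
    using block_conj_cong[of s S] S by simp
  \<comment> \<open>The carrier facts from here on follow the left-nested products from the inside
    out. They are the premises for merging the factors one at a time.\<close>
  have Tg: "\<forall>j<s. T j ^\<^sub>m g \<in> carrier_mat m m"
    and T1: "\<forall>j<s. 1\<^sub>m m - T j ^\<^sub>m g \<in> carrier_mat m m"
    using T by (auto intro!: minus_carrier_mat)
  have G1: "\<forall>j<s. P * (1\<^sub>m m - T j ^\<^sub>m g) \<in> carrier_mat n m"
    using P T1 by (auto intro: mult_carrier_mat)
  have G2: "\<forall>j<s. P * (1\<^sub>m m - T j ^\<^sub>m g) * mat_inv (D j) \<in> carrier_mat n m"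
    using G1 Di by (auto intro: mult_carrier_mat)
  have G3: "\<forall>j<s. P * (1\<^sub>m m - T j ^\<^sub>m g) * mat_inv (D j) * R \<in> carrier_mat n n"
    using G2 R by (auto intro: mult_carrier_mat)
  have G: "\<forall>j<s. P * (1\<^sub>m m - T j ^\<^sub>m g) * mat_inv (D j) * R * C j \<in> carrier_mat n n"
    using G3 C by (auto intro: mult_carrier_mat)
  have G': "\<forall>j<s. 1\<^sub>m n - P * (1\<^sub>m m - T j ^\<^sub>m g) * mat_inv (D j) * R * C j \<in> carrier_mat n n"
    using G by (auto intro!: minus_carrier_mat)
  have Spow: "\<forall>j<s. S j ^\<^sub>m k \<in> carrier_mat n n" for k
    using S_carrier by simp
  have SG: "\<forall>j<s. S j ^\<^sub>m k\<^sub>2 *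
      (1\<^sub>m n - P * (1\<^sub>m m - T j ^\<^sub>m g) * mat_inv (D j) * R * C j) \<in> carrier_mat n n"
    using Spow G' by (auto intro: mult_carrier_mat)
  show "S' ^\<^sub>m k\<^sub>2 *
      (1\<^sub>m (s * n) - (1\<^sub>m s \<otimes>\<^sub>K P) * (1\<^sub>m (s * m) - block_conj s X m m T ^\<^sub>m g) *
        mat_inv (block_conj s X m m D) * (1\<^sub>m s \<otimes>\<^sub>K R) * block_conj s X n n C) *
      S' ^\<^sub>m k\<^sub>1 = block_conj s X n n F"
    \<comment> \<open>Every ingredient first becomes a \<open>block_conj\<close>; powers,
      differences and products are then merged until a single \<open>block_conj\<close>
      remains.\<close>
    unfolding S'_eq to_block_conj F_def conj_pow[OF T] conj_pow[OF S_carrier]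
      conj_minus[OF one Tg] conj_mult[OF PR(1) T1] conj_mult[OF G1 Di] conj_mult[OF G2 PR(2)]
      conj_mult[OF G3 C] conj_minus[OF one G] conj_mult[OF Spow G'] conj_mult[OF SG Spow] ..
  show "\<forall>j<s. F j \<in> carrier_mat n n"
    unfolding F_def using SG Spow by (blast intro: mult_carrier_mat)
qed

theorem proposition4p1:
  fixes s l \<nu>\<^sub>1 \<nu>\<^sub>2 \<gamma> :: nat
    and A :: "real mat"
    and X \<Lambda> :: "complex mat"
    and emb :: "'k :: field \<Rightarrow> complex"
    and scale :: "'k \<Rightarrow> 'v :: ab_group_add \<Rightarrow> 'v"
    and V :: "nat \<Rightarrow> 'v set"
    and N :: "nat \<Rightarrow> nat"
    and b :: "nat \<Rightarrow> nat \<Rightarrow> 'v"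
    and Q :: "nat \<Rightarrow> 'k mat"
    and P R XX PP RR C W S T :: "nat \<Rightarrow> complex mat"
    and Cb Wb Sb :: "nat \<Rightarrow> nat \<Rightarrow> complex mat"
  \<comment> \<open>the diagonalized Butcher matrix\<close>
  assumes A: "A \<in> carrier_mat s s"
    and X: "X \<in> carrier_mat s s" "invertible_mat X"
    and Lambda: "\<Lambda> \<in> carrier_mat s s" "diagonal_mat \<Lambda>"
    and diagonalization: "map_mat complex_of_real A = X * \<Lambda> * mat_inv X"
  \<comment> \<open>nested spaces over a field embedded in the complex numbers (e.g. the reals), and transfers\<close>
    and emb: "field_hom emb"
    and scale: "Vector_Spaces.vector_space scale"
    and basis: "\<And>i. i \<le> l \<Longrightarrow> is_basis scale (V i) (N i) (b i)"
    and nested: "\<And>i. 1 \<le> i \<Longrightarrow> i \<le> l \<Longrightarrow> V (i - 1) \<subseteq> V i"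
    and Q: "\<And>i. 1 \<le> i \<Longrightarrow> i \<le> l \<Longrightarrow> is_inclusion_mat scale (N (i - 1)) (b (i - 1)) (N i) (b i) (Q i)"
    and P: "\<And>i. 1 \<le> i \<Longrightarrow> i \<le> l \<Longrightarrow> P i = map_mat emb (Q i)"
    and R: "\<And>i. 1 \<le> i \<Longrightarrow> i \<le> l \<Longrightarrow> R i \<in> carrier_mat (N (i - 1)) (N i)"
    and XX: "\<And>i. i \<le> l \<Longrightarrow> XX i = X \<otimes>\<^sub>K 1\<^sub>m (N i)"
    and PP: "\<And>i. 1 \<le> i \<Longrightarrow> i \<le> l \<Longrightarrow> PP i = 1\<^sub>m s \<otimes>\<^sub>K P i"
    and RR: "\<And>i. 1 \<le> i \<Longrightarrow> i \<le> l \<Longrightarrow> RR i = 1\<^sub>m s \<otimes>\<^sub>K R i"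
  \<comment> \<open>the multigrid iteration\<close>
    and l: "1 \<le> l"
    and \<gamma>: "1 \<le> \<gamma>"
    and C: "\<And>i. i \<le> l \<Longrightarrow> C i \<in> carrier_mat (s * N i) (s * N i)"
           "\<And>i. i \<le> l \<Longrightarrow> invertible_mat (C i)"
    and W: "\<And>i. 1 \<le> i \<Longrightarrow> i \<le> l \<Longrightarrow> W i \<in> carrier_mat (s * N i) (s * N i)"
           "\<And>i. 1 \<le> i \<Longrightarrow> i \<le> l \<Longrightarrow> invertible_mat (W i)"
    and S: "\<And>i. 1 \<le> i \<Longrightarrow> i \<le> l \<Longrightarrow> S i = 1\<^sub>m (s * N i) - mat_inv (W i) * C i"
    and T_0: "T 0 = 0\<^sub>m (s * N 0) (s * N 0)"
    and T_step: "\<And>i. 1 \<le> i \<Longrightarrow> i \<le> l \<Longrightarrow>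
      T i = S i ^\<^sub>m \<nu>\<^sub>2 *
        (1\<^sub>m (s * N i) -
          PP i * (1\<^sub>m (s * N (i - 1)) - T (i - 1) ^\<^sub>m \<gamma>) * mat_inv (C (i - 1)) * RR i * C i) *
        S i ^\<^sub>m \<nu>\<^sub>1"
  \<comment> \<open>monolithicity\<close>
    and C_mono: "\<And>i. i \<le> l \<Longrightarrow> monolithic s (N i) (XX i) (C i)"
    and Cb: "\<And>i j. i \<le> l \<Longrightarrow> j < s \<Longrightarrow> Cb i j \<in> carrier_mat (N i) (N i)"
            "\<And>i. i \<le> l \<Longrightarrow> C i = XX i * block_diag s (Cb i) * mat_inv (XX i)"
    and W_mono: "\<And>i. 1 \<le> i \<Longrightarrow> i \<le> l \<Longrightarrow> monolithic s (N i) (XX i) (W i)"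
    and Wb: "\<And>i j. 1 \<le> i \<Longrightarrow> i \<le> l \<Longrightarrow> j < s \<Longrightarrow> Wb i j \<in> carrier_mat (N i) (N i)"
            "\<And>i. 1 \<le> i \<Longrightarrow> i \<le> l \<Longrightarrow> W i = XX i * block_diag s (Wb i) * mat_inv (XX i)"
    and Sb: "\<And>i j. 1 \<le> i \<Longrightarrow> i \<le> l \<Longrightarrow> j < s \<Longrightarrow> Sb i j = 1\<^sub>m (N i) - mat_inv (Wb i j) * Cb i j"
  shows "(\<forall>i\<le>l. monolithic s (N i) (XX i) (T i)) \<and>
    (\<exists>Tb :: nat \<Rightarrow> nat \<Rightarrow> complex mat.
      (\<forall>i\<le>l. \<forall>j<s. Tb i j \<in> carrier_mat (N i) (N i)) \<and>
      (\<forall>j<s. Tb 0 j = 0\<^sub>m (N 0) (N 0)) \<and>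
      (\<forall>i\<le>l. T i = XX i * block_diag s (Tb i) * mat_inv (XX i)) \<and>
      (\<forall>i. 1 \<le> i \<longrightarrow> i \<le> l \<longrightarrow>
        T i = XX i *
          block_diag s (\<lambda>j. Sb i j ^\<^sub>m \<nu>\<^sub>2 *
            (1\<^sub>m (N i) -
              P i * (1\<^sub>m (N (i - 1)) - Tb (i - 1) j ^\<^sub>m \<gamma>) * mat_inv (Cb (i - 1) j) * R i * Cb i j) *
            Sb i j ^\<^sub>m \<nu>\<^sub>1) *
          mat_inv (XX i)))"
proof -
  \<comment> \<open>\<open>F i Y\<close> is the blockwise multigrid step to level \<open>i\<close>,
    applied to the family \<open>Y\<close> of coarse blocks.\<close>
  define F where "F i Y j = Sb i j ^\<^sub>m \<nu>\<^sub>2 *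
      (1\<^sub>m (N i) -
        P i * (1\<^sub>m (N (i - 1)) - Y j ^\<^sub>m \<gamma>) * mat_inv (Cb (i - 1) j) * R i * Cb i j) *
      Sb i j ^\<^sub>m \<nu>\<^sub>1" for i and Y :: "nat \<Rightarrow> complex mat" and j
  \<comment> \<open>The witness runs the recursion separately for each block. \<open>rec_nat\<close>
    hands over the index of the coarse level, so the step uses \<open>F (Suc i)\<close>.\<close>
  define Tb where "Tb = rec_nat (\<lambda>_. 0\<^sub>m (N 0) (N 0)) (\<lambda>i. F (Suc i))"
  have Tb_0: "Tb 0 = (\<lambda>_. 0\<^sub>m (N 0) (N 0))" and Tb_Suc: "Tb (Suc i) = F (Suc i) (Tb i)" for i
    by (simp_all add: Tb_def)
  have P_carrier: "P i \<in> carrier_mat (N i) (N (i - 1))" if "1 \<le> i" "i \<le> l" for i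
    using Q[OF that] P[OF that] by (simp add: is_inclusion_mat_def)
  have C_eq: "C i = block_conj s X (N i) (N i) (Cb i)" if "i \<le> l" for i
    using Cb(2)[OF that] XX[OF that] by (simp add: block_conj_def)
  have W_eq: "W i = block_conj s X (N i) (N i) (Wb i)" if "1 \<le> i" "i \<le> l" for i
    using Wb(2)[OF that] XX[OF that(2)] by (simp add: block_conj_def)
  \<comment> \<open>The block sizes are proved together with the equation, since the step lemma
    needs those of the coarse level.\<close>
  have T_eq: "T i = block_conj s X (N i) (N i) (Tb i) \<and> (\<forall>j<s. Tb i j \<in> carrier_mat (N i) (N i))"
    if "i \<le> l" for i
    using that
  proof (induction i)
    case 0
    show ?case
      using block_conj_zero[OF X, of "N 0"] by (simp add: T_0 Tb_0)
  next
    case (Suc i)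
    then have i: "1 \<le> Suc i" "Suc i \<le> l" "i \<le> l" and IH: "T i = block_conj s X (N i) (N i) (Tb i)"
      "\<forall>j<s. Tb i j \<in> carrier_mat (N i) (N i)"
      by auto
    have blocks: "\<forall>j<s. Cb (Suc i) j \<in> carrier_mat (N (Suc i)) (N (Suc i))"
      "\<forall>j<s. Cb i j \<in> carrier_mat (N i) (N i)"
      "\<forall>j<s. Wb (Suc i) j \<in> carrier_mat (N (Suc i)) (N (Suc i))"
      "\<forall>j<s. Sb (Suc i) j = 1\<^sub>m (N (Suc i)) - mat_inv (Wb (Suc i) j) * Cb (Suc i) j"
      using Cb(1) Wb(1) Sb i by auto
    \<comment> \<open>\<open>diff_Suc_1\<close> turns the coarse level \<open>Suc i - 1\<close> into
      \<open>i\<close>. The two resulting facts give the equation for \<open>T (Suc i)\<close> and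
      the sizes of its blocks.\<close>
    note step = multigrid_step_block_conj[OF X P_carrier[OF i(1,2), unfolded diff_Suc_1]
        R[OF i(1,2), unfolded diff_Suc_1] blocks(1,2) C(2)[OF i(3), unfolded C_eq[OF i(3)]]
        blocks(3) W(2)[OF i(1,2), unfolded W_eq[OF i(1,2)]] IH(2) blocks(4)
        S[OF i(1,2), unfolded W_eq[OF i(1,2)] C_eq[OF i(2)]],
        where g = \<gamma> and k\<^sub>1 = \<nu>\<^sub>1 and k\<^sub>2 = \<nu>\<^sub>2]
    show ?case
      using step
      by (simp add: T_step[OF i(1,2)] PP[OF i(1,2)] RR[OF i(1,2)] C_eq i IH(1) Tb_Suc F_def[abs_def])
  qed
  have F_eq: "Tb i = F i (Tb (i - 1))" if "1 \<le> i" for i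
    using that by (cases i) (auto simp: Tb_Suc)
  have T_block: "T i = XX i * block_diag s (Tb i) * mat_inv (XX i)" if "i \<le> l" for i
    using T_eq[OF that] XX[OF that] by (simp add: block_conj_def)
  have "monolithic s (N i) (XX i) (T i)" if "i \<le> l" for i
    using T_eq[OF that] monolithic_block_conj[OF X, of "Tb i"] by (simp add: XX[OF that])
  moreover have "T i = XX i * block_diag s (F i (Tb (i - 1))) * mat_inv (XX i)"
    if "1 \<le> i" "i \<le> l" for i
    using T_block[OF that(2)] F_eq[OF that(1)] by simp
  \<comment> \<open>The displayed block formula is the representation of \<open>T i\<close> by
    \<open>Tb i\<close> with one step of the recursion unfolded.\<close>
  ultimately show ?thesis
    using T_eq T_block Tb_0 by (intro conjI exI[of _ Tb]) (auto simp: F_def[abs_def])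
qed

end
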